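(* Let $X$ be a weakly pervasive pre-Riesz space and let $B,D\subseteq X$ be two directed ideals such that $X=B\oplus D$ (algebraic direct sum). Then $B$ is a projection band, and $X=B\oplus B^{\mathrm{d}}$.
   Context: All vector spaces are real. An ordered vector space $X$ is a real vector space with a cone $X_+$ (closed under addition and multiplication by nonnegative scalars, $X_+\cap(-X_+)=\{0\}$), ordered by $x\le y$ iff $y-x\in X_+$. A linear subspace $D$ of an ordered vector space $Y$ is order dense in $Y$ if $y=\inf\{z\in D: y\le z\}$ for every $y\in Y$. An ordered vector space $X$ is a pre-Riesz space if there exist a vector lattice $Y$ and a bipositive linear map $i\colon X\to Y$ (i.e. $i(x)\ge 0$ iff $x\ge 0$) such that $i(X)$ is order dense in $Y$; then $(Y,i)$ is called a vector lattice cover of $X$. For $M\subseteq X$, $M^u$ is the set of upper bounds of $M$ in $X$. Elements $x,y\in X$ are disjoint, $x\perp y$, if $\{x+y,-x-y\}^u=\{x-y,-x+y\}^u$. A pre-Riesz space $X$ is weakly pervasive if for all $b,d\in X$ with $b,d>0$ and $b\not\perp d$ there exists $x\in X$ with $0<x\le b$ and $x\le d$. The disjoint complement of $M\subseteq X$ is $M^{\mathrm{d}}=\{x\in X: x\perp y\text{ for all }y\in M\}$, and $M^{\mathrm{dd}}=(M^{\mathrm{d}})^{\mathrm{d}}$. A linear subspace $B$ is a band if $B^{\mathrm{dd}}=B$; a band $B$ is a projection band if $X=B\oplus B^{\mathrm{d}}$. A subset $M\subseteq X$ is solid if for all $x\in X$, $y\in M$ the inclusion $\{x,-x\}^u\supseteq\{y,-y\}^u$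 implies $x\in M$; an ideal is a solid linear subspace. A linear subspace $D\subseteq X$ is directed if for all $x,y\in D$ there is $z\in D$ with $x\le z$ and $y\le z$. *)

theory Defs
  imports Complex_Main "HOL-Library.Lub_Glb"
begin

text \<open>
  An ordered vector space is a type of class \<^class>\<open>ordered_real_vector\<close>, with cone
  \<open>{x. 0 \<le> x}\<close>; a vector lattice is a type that is in addition of class \<^class>\<open>lattice\<close>.
\<close>

definition order_dense :: "'a::ordered_real_vector set \<Rightarrow> bool" where
  "order_dense D \<longleftrightarrow> subspace D \<and> (\<forall>y. isGlb UNIV {z \<in> D. y \<le> z} y)"

definition bipositive :: "('a::ordered_real_vector \<Rightarrow> 'b::ordered_real_vector) \<Rightarrow> bool" where
  "bipositive i \<longleftrightarrow> (\<forall>x. 0 \<le> i x \<longleftrightarrow> 0 \<le> x)"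

text \<open>
  The space \<open>'a\<close> is a pre-Riesz space iff it has a vector lattice cover \<open>(Y, i)\<close>.
  HOL cannot quantify existentially over the type \<open>Y\<close>. A theorem about a pre-Riesz space
  therefore assumes a vector lattice cover \<open>i\<close> into an arbitrary type \<open>'y\<close>: as \<open>i\<close> and \<open>'y\<close>
  do not occur in its conclusion, this is the hypothesis that some cover exists.
\<close>

definition vector_lattice_cover ::
    "('a::ordered_real_vector \<Rightarrow> 'y::{ordered_real_vector, lattice}) \<Rightarrow> bool" where
  "vector_lattice_cover i \<longleftrightarrow> linear i \<and> bipositive i \<and> order_dense (range i)"

definition upper_bounds :: "'a::ordered_real_vector set \<Rightarrow> 'a set" where
  "upper_bounds M = ubs UNIV M"

definition disjoint_elems :: "'a::ordered_real_vector \<Rightarrow> 'a \<Rightarrow> bool" where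
  "disjoint_elems x y \<longleftrightarrow> upper_bounds {x + y, - x - y} = upper_bounds {x - y, - x + y}"

definition weakly_pervasive :: "'a::ordered_real_vector itself \<Rightarrow> bool" where
  "weakly_pervasive (_ :: 'a itself) \<longleftrightarrow>
    (\<forall>b d :: 'a. 0 < b \<and> 0 < d \<and> \<not> disjoint_elems b d \<longrightarrow> (\<exists>x. 0 < x \<and> x \<le> b \<and> x \<le> d))"

definition disjoint_complement :: "'a::ordered_real_vector set \<Rightarrow> 'a set" where
  "disjoint_complement M = {x. \<forall>y\<in>M. disjoint_elems x y}"

definition direct_sum_decomp :: "'a::real_vector set \<Rightarrow> 'a set \<Rightarrow> bool" where
  "direct_sum_decomp B D \<longleftrightarrow>
    subspace B \<and> subspace D \<and> (\<forall>x. \<exists>b\<in>B. \<exists>d\<in>D. x = b + d) \<and> B \<inter> D = {0}"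

definition band :: "'a::ordered_real_vector set \<Rightarrow> bool" where
  "band B \<longleftrightarrow> subspace B \<and> disjoint_complement (disjoint_complement B) = B"

definition projection_band :: "'a::ordered_real_vector set \<Rightarrow> bool" where
  "projection_band B \<longleftrightarrow> band B \<and> direct_sum_decomp B (disjoint_complement B)"

definition solid :: "'a::ordered_real_vector set \<Rightarrow> bool" where
  "solid M \<longleftrightarrow> (\<forall>x. \<forall>y\<in>M. upper_bounds {y, - y} \<subseteq> upper_bounds {x, - x} \<longrightarrow> x \<in> M)"

definition order_ideal :: "'a::ordered_real_vector set \<Rightarrow> bool" where
  "order_ideal M \<longleftrightarrow> subspace M \<and> solid M"

definition directed :: "'a::ordered_real_vector set \<Rightarrow> bool" where
  "directed D \<longleftrightarrow> (\<forall>x\<in>D. \<forall>y\<in>D. \<exists>z\<in>D. x \<le> z \<and> y \<le> z)"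

end

theory Submission
  imports Defs
begin

text \<open>
  Positive elements \<open>b \<in> B\<close> and \<open>d \<in> D\<close> are disjoint: otherwise weak pervasiveness gives
  some \<open>x\<close> with \<open>0 < x \<le> b\<close> and \<open>x \<le> d\<close>, and \<open>x \<in> B \<inter> D = {0}\<close> since ideals are solid.
  The idea is that this disjointness makes the decomposition \<open>X = B \<oplus> D\<close> respect the order
  (\<open>disjoint_cones_sum_nonneg\<close>): if \<open>0 \<le> b + d\<close> then \<open>0 \<le> b\<close> and \<open>0 \<le> d\<close>.

  An upper bound of \<open>{b - d, d - b}\<close> is a sum \<open>w + v\<close> with \<open>w \<in> B\<close> and \<open>v \<in> D\<close>. Comparing
  components, \<open>w\<close> is an upper bound of \<open>{b, - b}\<close> and \<open>v\<close> one of \<open>{d, - d}\<close>, so \<open>w + v\<close> bounds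
  \<open>{b + d, - b - d}\<close> as well. Hence all of \<open>B\<close> is disjoint from all of \<open>D\<close>, that is,
  \<open>D \<subseteq> B\<^sup>d\<close> (\<open>disjoint_if_disjoint_cones\<close>).

  Conversely, let \<open>b + d \<in> B\<^sup>d\<close>. From \<open>b + d \<bottom> b\<close> and \<open>d \<bottom> 2 b\<close>, the sets
  \<open>{2 b + d, - 2 b - d}\<close>, \<open>{d, - d}\<close> and \<open>{2 b - d, d - 2 b}\<close> have the same upper bounds. As
  \<open>2 b\<close> is the mean of \<open>2 b + d\<close> and \<open>2 b - d\<close>, each such upper bound also bounds
  \<open>{2 b, - 2 b}\<close>. So \<open>2 b \<in> D\<close> by solidity, \<open>b = 0\<close>, and \<open>b + d \<in> D\<close>
  (\<open>disjoint_complement_eq\<close>). Thus \<open>B\<^sup>d = D\<close>, by symmetry \<open>D\<^sup>d = B\<close>, and \<open>B\<close> is a band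
  with complement \<open>D\<close>.
\<close>

lemma mem_upper_bounds_pair: "z \<in> upper_bounds {x, y} \<longleftrightarrow> x \<le> z \<and> y \<le> z"
  by (simp add: upper_bounds_def ubs_def isUb_def setle_def)

lemma disjoint_elems_iff:
  "disjoint_elems x y \<longleftrightarrow>
    (\<forall>z. x + y \<le> z \<and> - x - y \<le> z \<longleftrightarrow> x - y \<le> z \<and> - x + y \<le> z)"
  by (simp add: disjoint_elems_def set_eq_iff mem_upper_bounds_pair)

lemma disjoint_elems_commute: "disjoint_elems x y \<longleftrightarrow> disjoint_elems y x"
proof -
  have "x + y = y + x" "- x - y = - y - x" "x - y = - y + x" "- x + y = y - x"
    by simp_all
  then show ?thesis
    unfolding disjoint_elems_iff by metis
qed

lemma disjoint_elems_zero_left: "disjoint_elems 0 x"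
  by (auto simp: disjoint_elems_iff)

lemma double_le_double_iff:
  fixes x y :: "'a::ordered_real_vector"
  shows "x + x \<le> y + y \<longleftrightarrow> x \<le> y"
  using scaleR_le_cancel_left_pos[of 2 x y] by (simp add: scaleR_2)

text \<open>
  In a vector lattice this is \<open>q \<le> p + (q \<sqinter> r)\<close> with \<open>q \<sqinter> r = 0\<close> for positive \<open>q\<close> and \<open>r\<close>;
  here infima need not exist, and the definition of disjointness by upper bounds is used.
\<close>

lemma le_add_disjoint_cancel:
  assumes "disjoint_elems q r" "0 \<le> p" "q \<le> p + r"
  shows "q \<le> p"
proof -
  \<comment> \<open>\<open>?z\<close> is an upper bound of \<open>{q - r, r - q}\<close>, hence of \<open>q + r\<close>; and \<open>q + r \<le> ?z\<close> says
    \<open>2 q \<le> 2 p\<close>.\<close>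
  let ?z = "p + p + r - q"
  have "q - r \<le> ?z"
  proof -
    have "q + q \<le> (p + r) + (p + r)"
      using assms(3) by (intro add_mono)
    then show ?thesis
      by (simp add: algebra_simps)
  qed
  moreover have "- q + r \<le> ?z"
    using add_mono[OF assms(2) assms(2)] by (simp add: algebra_simps)
  ultimately have "q + r \<le> ?z"
    using assms(1) unfolding disjoint_elems_iff by blast
  then have "(q + r) + (q - r) \<le> (p + p + r - q) + (q - r)"
    by (rule add_right_mono)
  then have "q + q \<le> p + p"
    by simp
  then show ?thesis
    by (simp add: double_le_double_iff)
qed

lemma directed_subspace_decomp:
  fixes B :: "'a::ordered_real_vector set"
  assumes "subspace B" "directed B" "b \<in> B"
  obtains p q where "p \<in> B" "q \<in> B" "0 \<le> p" "0 \<le> q" "b = p - q"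
proof -
  have "0 \<in> B"
    using assms(1) by (rule subspace_0)
  then obtain z where z: "z \<in> B" "b \<le> z" "0 \<le> z"
    using assms(2,3) unfolding directed_def by blast
  moreover have "z - b \<in> B"
    using assms(1,3) z(1) by (intro subspace_diff)
  ultimately show ?thesis
    using that[of z "z - b"] by simp
qed

text \<open>
  The components of a positive element along \<open>B\<close> and \<open>D\<close> are positive. Writing \<open>b = p - q\<close> and
  \<open>d = r - s\<close> as differences of positive elements turns \<open>0 \<le> b + d\<close> into \<open>q + s \<le> p + r\<close>,
  and the disjoint terms \<open>r\<close> and \<open>p\<close> cancel in \<open>q \<le> p + r\<close> and \<open>s \<le> r + p\<close>.
\<close>

lemma disjoint_cones_sum_nonneg:
  fixes B D :: "'a::ordered_real_vector set"
  assumes B: "subspace B" "directed B"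
    and D: "subspace D" "directed D"
    and disj: "\<And>b d. b \<in> B \<Longrightarrow> d \<in> D \<Longrightarrow> 0 \<le> b \<Longrightarrow> 0 \<le> d \<Longrightarrow> disjoint_elems b d"
    and "b \<in> B" "d \<in> D" "0 \<le> b + d"
  shows "0 \<le> b" "0 \<le> d"
proof -
  obtain p q where pq: "p \<in> B" "q \<in> B" "0 \<le> p" "0 \<le> q" "b = p - q"
    using directed_subspace_decomp[OF B \<open>b \<in> B\<close>] .
  obtain r s where rs: "r \<in> D" "s \<in> D" "0 \<le> r" "0 \<le> s" "d = r - s"
    using directed_subspace_decomp[OF D \<open>d \<in> D\<close>] .
  have le: "q + s \<le> p + r"
    using \<open>0 \<le> b + d\<close> pq(5) rs(5) by (simp add: algebra_simps)
  have "q \<le> p + r"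
    using le rs(4) by (meson le_add_same_cancel1 order_trans)
  with disj[OF pq(2) rs(1) pq(4) rs(3)] pq(3) have "q \<le> p"
    by (rule le_add_disjoint_cancel)
  then show "0 \<le> b"
    using pq(5) by simp
  have "s \<le> r + p"
    using le pq(4) by (metis add.commute le_add_same_cancel2 order_trans)
  moreover have "disjoint_elems s p"
    using disj[OF pq(1) rs(2) pq(3) rs(4)] by (simp add: disjoint_elems_commute)
  ultimately have "s \<le> r"
    using rs(3) le_add_disjoint_cancel by blast
  then show "0 \<le> d"
    using rs(5) by simp
qed

lemma disjoint_if_disjoint_cones:
  fixes B D :: "'a::ordered_real_vector set"
  assumes sum: "direct_sum_decomp B D"
    and dir: "directed B" "directed D"
    and disj: "\<And>b d. b \<in> B \<Longrightarrow> d \<in> D \<Longrightarrow> 0 \<le> b \<Longrightarrow> 0 \<le> d \<Longrightarrow> disjoint_elems b d"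
    and "b \<in> B" "d \<in> D"
  shows "disjoint_elems b d"
proof -
  have sB: "subspace B" and sD: "subspace D"
    using sum by (auto simp: direct_sum_decomp_def)
  have nonneg: "0 \<le> w" "0 \<le> v" if "w \<in> B" "v \<in> D" "0 \<le> w + v" for w v
    using disjoint_cones_sum_nonneg[OF sB dir(1) sD dir(2) _ that] disj by blast+
  have bound: "b + d' \<le> z" "- b - d' \<le> z"
    if "d' \<in> D" and z: "b - d' \<le> z" "- b + d' \<le> z" for d' z
  proof -
    obtain w v where wv: "w \<in> B" "v \<in> D" "z = w + v"
      using sum unfolding direct_sum_decomp_def by blast
    have mem: "w - b \<in> B" "w + b \<in> B" "v - d' \<in> D" "v + d' \<in> D"
      using sB sD wv \<open>b \<in> B\<close> \<open>d' \<in> D\<close> by (auto intro: subspace_diff subspace_add)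
    have "0 \<le> (w - b) + (v + d')" "0 \<le> (w + b) + (v - d')"
      using z wv(3) by (simp_all add: algebra_simps)
    then have "0 \<le> w - b" "0 \<le> v + d'" "0 \<le> w + b" "0 \<le> v - d'"
      using nonneg[OF mem(1) mem(4)] nonneg[OF mem(2) mem(3)] by blast+
    then have "b \<le> w" "- b \<le> w" "d' \<le> v" "- d' \<le> v"
      using diff_ge_0_iff_ge[of w "- b"] diff_ge_0_iff_ge[of v "- d'"] by simp_all
    then show "b + d' \<le> z" "- b - d' \<le> z"
      using wv(3) add_mono[of b w d' v] add_mono[of "- b" w "- d'" v] by simp_all
  qed
  \<comment> \<open>Replacing \<open>d\<close> by \<open>- d\<close> gives the reverse inclusion of the sets of upper bounds.\<close>
  have "- d \<in> D"
    using sD \<open>d \<in> D\<close> by (rule subspace_neg)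
  then have neg: "b - d \<le> z" "- b + d \<le> z" if "b + d \<le> z" "- b - d \<le> z" for z
    using bound[of "- d" z] that by simp_all
  show ?thesis
    unfolding disjoint_elems_iff
    using bound[OF \<open>d \<in> D\<close>] neg by blast
qed

lemma order_ideal_interval:
  assumes "order_ideal B" "b \<in> B" "0 \<le> x" "x \<le> b"
  shows "x \<in> B"
proof -
  have "- x \<le> x"
    using assms(3) by (meson neg_le_0_iff_le order_trans)
  then have "upper_bounds {b, - b} \<subseteq> upper_bounds {x, - x}"
    using assms(4) by (auto simp: mem_upper_bounds_pair)
  then show ?thesis
    using assms(1,2) unfolding order_ideal_def solid_def by blast
qed

lemma disjoint_positive_if_weakly_pervasive:
  fixes B D :: "'a::ordered_real_vector set"
  assumes "weakly_pervasive TYPE('a)" "order_ideal B" "order_ideal D" "B \<inter> D = {0}"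
    and "b \<in> B" "d \<in> D" "0 \<le> b" "0 \<le> d"
  shows "disjoint_elems b d"
proof (rule ccontr)
  assume nd: "\<not> disjoint_elems b d"
  then have "b \<noteq> 0" "d \<noteq> 0"
    using disjoint_elems_zero_left disjoint_elems_commute by metis+
  then have "0 < b" "0 < d"
    using assms(7,8) by (auto simp: less_le)
  then obtain x where x: "0 < x" "x \<le> b" "x \<le> d"
    using assms(1) nd unfolding weakly_pervasive_def by blast
  then have "x \<in> B \<inter> D"
    using assms order_ideal_interval[of _ _ x] by (auto simp: less_imp_le)
  then show False
    using x(1) assms(4) by auto
qed

lemma disjoint_complement_eq:
  fixes B D :: "'a::ordered_real_vector set"
  assumes sum: "direct_sum_decomp B D" and "solid D"
    and disj: "\<And>b d. b \<in> B \<Longrightarrow> d \<in> D \<Longrightarrow> disjoint_elems b d"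
  shows "disjoint_complement B = D"
proof
  show "D \<subseteq> disjoint_complement B"
    using disj disjoint_elems_commute by (auto simp: disjoint_complement_def)
next
  have sB: "subspace B" and sD: "subspace D" and int: "B \<inter> D = {0}"
    using sum by (auto simp: direct_sum_decomp_def)
  show "disjoint_complement B \<subseteq> D"
  proof
    fix x
    assume x: "x \<in> disjoint_complement B"
    obtain b d where bd: "b \<in> B" "d \<in> D" "x = b + d"
      using sum unfolding direct_sum_decomp_def by blast
    have 2: "b + b \<in> B"
      using sB bd(1) by (intro subspace_add)
    have "upper_bounds {d, - d} \<subseteq> upper_bounds {b + b, - (b + b)}"
    proof
      fix u
      assume "u \<in> upper_bounds {d, - d}"
      then have u: "d \<le> u" "- d \<le> u"
        by (simp_all add: mem_upper_bounds_pair)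
      have "disjoint_elems (b + d) b"
        using x bd by (simp add: disjoint_complement_def)
      from this[unfolded disjoint_elems_iff, rule_format, of u]
      have plus: "b + b + d \<le> u" "- (b + b) - d \<le> u"
        using u by (simp_all add: algebra_simps)
      from disj[OF 2 bd(2), unfolded disjoint_elems_iff, rule_format, of u]
      have minus: "b + b - d \<le> u" "- (b + b) + d \<le> u"
        using plus by simp_all
      have "(b + b) + (b + b) \<le> u + u"
        using add_mono[OF plus(1) minus(1)] by (simp add: algebra_simps)
      moreover have "- (b + b) + - (b + b) \<le> u + u"
        using add_mono[OF plus(2) minus(2)] by (simp add: algebra_simps)
      ultimately show "u \<in> upper_bounds {b + b, - (b + b)}"
        unfolding double_le_double_iff by (simp add: mem_upper_bounds_pair)
    qed
    then have "b + b \<in> D"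
      using \<open>solid D\<close> bd(2) unfolding solid_def by blast
    with 2 int have "b + b = 0"
      by blast
    then have "b = 0"
      using scaleR_2[of b] by simp
    then show "x \<in> D"
      using bd by simp
  qed
qed

lemma direct_sum_decomp_commute: "direct_sum_decomp B D \<longleftrightarrow> direct_sum_decomp D B"
proof -
  have "(\<exists>b\<in>B. \<exists>d\<in>D. x = b + d) \<longleftrightarrow> (\<exists>d\<in>D. \<exists>b\<in>B. x = d + b)" for x
    by (metis add.commute)
  then show ?thesis
    by (simp add: direct_sum_decomp_def Int_commute conj_left_commute)
qed

theorem theorem18:
  fixes i :: "'a::ordered_real_vector \<Rightarrow> 'y::{ordered_real_vector, lattice}"
    and B D :: "'a set"
  assumes "vector_lattice_cover i"
    and "weakly_pervasive TYPE('a)"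
    and "order_ideal B" and "directed B"
    and "order_ideal D" and "directed D"
    and "direct_sum_decomp B D"
  shows "projection_band B \<and> direct_sum_decomp B (disjoint_complement B)"
proof -
  have "B \<inter> D = {0}"
    using assms(7) by (simp add: direct_sum_decomp_def)
  note positive = disjoint_positive_if_weakly_pervasive[OF assms(2,3,5) this]
  have disj: "disjoint_elems b d" if "b \<in> B" "d \<in> D" for b d
    using disjoint_if_disjoint_cones[OF assms(7,4,6) _ that] positive by blast
  have D: "disjoint_complement B = D"
    using assms(5) disj
    by (intro disjoint_complement_eq[OF assms(7)]) (simp_all add: order_ideal_def)
  have "disjoint_complement D = B"
  proof (rule disjoint_complement_eq)
    show "direct_sum_decomp D B"
      using assms(7) by (simp only: direct_sum_decomp_commute[of D B])
    show "solid B"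
      using assms(3) by (simp add: order_ideal_def)
    show "disjoint_elems d b" if "d \<in> D" "b \<in> B" for d b
      using disj[OF that(2,1)] by (simp only: disjoint_elems_commute[of d b])
  qed
  with D show ?thesis
    using assms(3,7) by (simp add: projection_band_def band_def order_ideal_def)
qed

end
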